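(* For $0<\rho<1$ and a convex quadrilateral $ABCD$ with vertices listed counterclockwise, let $r(\rho,ABCD)=\text{area}(EFGH)/\text{area}(ABCD)$, where $EFGH$ is the inner quadrilateral formed by joining vertices to $\rho$-points, and let $$M(\rho)=\frac{(1-\rho)^2}{\rho^2+1},$$ which is the maximal value of $r(\rho,\cdot)$ over all convex quadrilaterals. Then: (i) if $ABCD$ is a parallelogram, then $r(\rho,ABCD)=M(\rho)$ for every $\rho\in(0,1)$; (ii) if $ABCD$ is a convex quadrilateral for which $r(\rho,ABCD)=M(\rho)$ holds for more than one value of $\rho\in(0,1)$, then $ABCD$ is a parallelogram.
   Context: All figures are in the Euclidean plane. Convex quadrilaterals are nondegenerate (no three vertices collinear). For a convex quadrilateral with vertices $A,B,C,D$ in counterclockwise order and $0<\rho<1$, the $\rho$-point of a side $XY$ (with $Y$ the next vertex after $X$ counterclockwise) is the point $X+\rho(Y-X)$. Let $N_1,N_2,N_3,N_4$ be the $\rho$-points of $BC$, $CD$, $DA$, $AB$ respectively. Draw the segments $AN_1$, $BN_2$, $CN_3$, $DN_4$. The inner quadrilateral $EFGH$ is the one with vertices $E=AN_1\cap BN_2$, $F=BN_2\cap CN_3$, $G=CN_3\cap DN_4$, $H=DN_4\cap AN_1$. *)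

theory Defs
  imports "HOL-Analysis.Analysis"
begin

text \<open>Twice the signed area of the triangle \<open>X Y Z\<close>; it is positive iff \<open>Z\<close> lies
  strictly to the left of the directed line from \<open>X\<close> to \<open>Y\<close>.\<close>

definition orient :: "real^2 \<Rightarrow> real^2 \<Rightarrow> real^2 \<Rightarrow> real" where
  "orient X Y Z = det (vector [Y - X, Z - X] :: real^2^2)"

text \<open>A polygon with vertices listed counterclockwise is convex when it lies to the left of the
  directed line through each of its sides. Strict inequalities express that no three vertices are
  collinear; see \<open>ccw_convex_quad_iff\<close>.\<close>

definition ccw_convex_quad :: "real^2 \<Rightarrow> real^2 \<Rightarrow> real^2 \<Rightarrow> real^2 \<Rightarrow> bool" where
  "ccw_convex_quad A B C D \<longleftrightarrow>
     (\<forall>Z\<in>{C, D}. orient A B Z > 0) \<and>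
     (\<forall>Z\<in>{D, A}. orient B C Z > 0) \<and>
     (\<forall>Z\<in>{A, B}. orient C D Z > 0) \<and>
     (\<forall>Z\<in>{B, C}. orient D A Z > 0)"

definition parallelogram :: "real^2 \<Rightarrow> real^2 \<Rightarrow> real^2 \<Rightarrow> real^2 \<Rightarrow> bool" where
  "parallelogram A B C D \<longleftrightarrow>
     collinear {0, B - A, D - C} \<and> collinear {0, C - B, A - D}"

text \<open>The area is that of the convex hull, which is the region bounded by the quadrilateral
  whenever the quadrilateral is convex. Both the outer quadrilateral and the inner
  quadrilateral are.\<close>

definition quad_area :: "real^2 \<Rightarrow> real^2 \<Rightarrow> real^2 \<Rightarrow> real^2 \<Rightarrow> real" where
  "quad_area P Q R S = measure lebesgue (convex hull {P, Q, R, S})"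

definition rho_point :: "real \<Rightarrow> real^2 \<Rightarrow> real^2 \<Rightarrow> real^2" where
  "rho_point \<rho> X Y = X + \<rho> *\<^sub>R (Y - X)"

text \<open>The unique common point of two segments (unspecified if there is not exactly one).\<close>

definition segment_meet :: "real^2 \<Rightarrow> real^2 \<Rightarrow> real^2 \<Rightarrow> real^2 \<Rightarrow> real^2" where
  "segment_meet X Y X' Y' = the_elem (closed_segment X Y \<inter> closed_segment X' Y')"

definition inner_area :: "real \<Rightarrow> real^2 \<Rightarrow> real^2 \<Rightarrow> real^2 \<Rightarrow> real^2 \<Rightarrow> real" where
  "inner_area \<rho> A B C D =
    (let N1 = rho_point \<rho> B C;
         N2 = rho_point \<rho> C D;
         N3 = rho_point \<rho> D A;
         N4 = rho_point \<rho> A B;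
         E = segment_meet A N1 B N2;
         F = segment_meet B N2 C N3;
         G = segment_meet C N3 D N4;
         H = segment_meet D N4 A N1
     in quad_area E F G H)"

definition area_ratio :: "real \<Rightarrow> real^2 \<Rightarrow> real^2 \<Rightarrow> real^2 \<Rightarrow> real^2 \<Rightarrow> real" where
  "area_ratio \<rho> A B C D = inner_area \<rho> A B C D / quad_area A B C D"

definition M :: "real \<Rightarrow> real" where
  "M \<rho> = (1 - \<rho>)\<^sup>2 / (\<rho>\<^sup>2 + 1)"

lemma orient_eq:
  "orient X Y Z = (Y$1 - X$1) * (Z$2 - X$2) - (Y$2 - X$2) * (Z$1 - X$1)"
  by (simp add: orient_def det_2 algebra_simps)

lemma collinear_iff_orient: "collinear {X, Y, Z} \<longleftrightarrow> orient X Y Z = 0"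
proof -
  have "collinear {X, Y, Z} \<longleftrightarrow> collinear {0, Y - X, Z - X}"
    using collinear_3[of Y X Z] by (simp add: insert_commute)
  also have "\<dots> \<longleftrightarrow> orient X Y Z = 0"
  proof
    assume "collinear {0, Y - X, Z - X}"
    then consider "Y = X" | "Z = X" | c where "Z - X = c *\<^sub>R (Y - X)"
      unfolding collinear_lemma by auto
    then show "orient X Y Z = 0"
    proof cases
      case (3 c)
      then have "Z$i - X$i = c * (Y$i - X$i)" for i
        by (auto dest: arg_cong[where f = "\<lambda>v. v $ i"])
      then show ?thesis by (simp add: orient_eq)
    qed (auto simp: orient_eq)
  next
    assume o: "orient X Y Z = 0"
    show "collinear {0, Y - X, Z - X}"
    proof (cases "Y = X")
      case False
      then consider "Y$1 \<noteq> X$1" | "Y$2 \<noteq> X$2"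
        by (auto simp: vec_eq_iff forall_2)
      then have "\<exists>c. Z - X = c *\<^sub>R (Y - X)"
      proof cases
        case 1
        then have "Z$2 - X$2 = (Z$1 - X$1) / (Y$1 - X$1) * (Y$2 - X$2)"
          using o by (simp add: orient_eq nonzero_eq_divide_eq mult.commute)
        with 1 show ?thesis
          by (intro exI[of _ "(Z$1 - X$1) / (Y$1 - X$1)"]) (simp add: vec_eq_iff forall_2)
      next
        case 2
        then have "Z$1 - X$1 = (Z$2 - X$2) / (Y$2 - X$2) * (Y$1 - X$1)"
          using o by (simp add: orient_eq nonzero_eq_divide_eq mult.commute)
        with 2 show ?thesis
          by (intro exI[of _ "(Z$2 - X$2) / (Y$2 - X$2)"]) (simp add: vec_eq_iff forall_2)
      qed
      then show ?thesis unfolding collinear_lemma by blast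
    qed simp
  qed
  finally show ?thesis .
qed

text \<open>Equivalently: no three vertices are collinear, the diagonals cross, and the vertices are
  listed counterclockwise.\<close>

lemma ccw_convex_quad_iff:
  "ccw_convex_quad A B C D \<longleftrightarrow>
     \<not> collinear {A, B, C} \<and> \<not> collinear {B, C, D} \<and>
     \<not> collinear {C, D, A} \<and> \<not> collinear {D, A, B} \<and>
     closed_segment A C \<inter> closed_segment B D \<noteq> {} \<and> orient A B C > 0"
    (is "?L \<longleftrightarrow> ?R")
proof
  assume L: ?L
  define p where "p = orient A B C"
  define q where "q = orient C D A"
  define s where "s = orient D A B"
  define t where "t = orient B C D"
  have pos: "p > 0" "q > 0" "s > 0" "t > 0"
    using L by (auto simp: ccw_convex_quad_def p_def q_def s_def t_def)
  have pqst: "p + q = s + t"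
    by (simp add: p_def q_def s_def t_def orient_eq algebra_simps)
  define P where "P = (1 - s / (s + t)) *\<^sub>R A + (s / (s + t)) *\<^sub>R C"
  have PA: "P \<in> closed_segment A C"
    unfolding P_def in_segment using pos by (intro exI[of _ "s / (s + t)"]) simp
  have "P = (1 - p / (s + t)) *\<^sub>R B + (p / (s + t)) *\<^sub>R D"
  proof -
    have "t * A$i + s * C$i = q * B$i + p * D$i" for i
      using exhaust_2[of i]
      by (auto simp: p_def q_def s_def t_def orient_eq algebra_simps)
    then have "(t * A$i + s * C$i) / (s + t) = (q * B$i + p * D$i) / (s + t)" for i
      by simp
    moreover have "1 - s / (s + t) = t / (s + t)"
      using pos by (simp add: divide_simps)
    moreover have "1 - p / (s + t) = q / (s + t)"
      using pos pqst[symmetric] by (simp add: divide_simps)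
    ultimately show ?thesis
      unfolding P_def by (simp add: vec_eq_iff add_divide_distrib)
  qed
  then have "P \<in> closed_segment B D"
    unfolding in_segment using pos pqst by (intro exI[of _ "p / (s + t)"]) simp
  with PA pos show ?R
    by (auto simp: collinear_iff_orient p_def q_def s_def t_def)
next
  assume R: ?R
  then obtain P u v where P: "P = (1 - u) *\<^sub>R A + u *\<^sub>R C" "P = (1 - v) *\<^sub>R B + v *\<^sub>R D"
    and uv: "0 \<le> u" "u \<le> 1" "0 \<le> v" "v \<le> 1"
    unfolding ex_in_conv[symmetric] Int_iff in_segment by blast
  have e: "(1 - u) * A$i + u * C$i = (1 - v) * B$i + v * D$i" for i
    using arg_cong[OF P(1)[symmetric, unfolded P(2)], of "\<lambda>x. x $ i"] by simp
  define W where "W = orient A B C + orient C D A"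
  have W': "W = (C$1 - A$1) * (D$2 - B$2) - (C$2 - A$2) * (D$1 - B$1)"
    by (simp add: W_def orient_eq algebra_simps)
  have u1: "u * (C$i - A$i) = (B$i - A$i) + v * (D$i - B$i)" for i
    using e[of i] by (simp add: algebra_simps)
  have v1: "v * (D$i - B$i) = (A$i - B$i) + u * (C$i - A$i)" for i
    using e[of i] by (simp add: algebra_simps)
  have "u * W = (u * (C$1 - A$1)) * (D$2 - B$2) - (u * (C$2 - A$2)) * (D$1 - B$1)"
    by (simp add: W' algebra_simps)
  also have "\<dots> = orient D A B"
    by (simp only: u1) (simp add: orient_eq algebra_simps)
  finally have uW: "u * W = orient D A B" .
  have "v * W = (C$1 - A$1) * (v * (D$2 - B$2)) - (C$2 - A$2) * (v * (D$1 - B$1))"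
    by (simp add: W' algebra_simps)
  also have "\<dots> = orient A B C"
    by (simp only: v1) (simp add: orient_eq algebra_simps)
  finally have vW: "v * W = orient A B C" .
  have t: "(1 - u) * W = orient B C D"
    using uW by (simp add: algebra_simps) (simp add: W_def orient_eq algebra_simps)
  have q: "(1 - v) * W = orient C D A"
    using vW by (simp add: algebra_simps W_def)
  have "W > 0"
    using R vW uv by (metis zero_less_mult_iff not_less)
  then have "orient D A B \<ge> 0" "orient B C D \<ge> 0" "orient C D A \<ge> 0"
    using uv uW t q by (metis less_imp_le mult_nonneg_nonneg diff_ge_0_iff_ge)+
  then have "orient D A B > 0" "orient B C D > 0" "orient C D A > 0" "orient A B C > 0"
    using R by (auto simp: collinear_iff_orient)
  moreover have "orient A B D = orient D A B" "orient B C A = orient A B C"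
    "orient C D B = orient B C D" "orient D A C = orient C D A"
    by (simp_all add: orient_eq algebra_simps)
  ultimately show ?L
    by (auto simp: ccw_convex_quad_def)
qed

end

theory Submission
  imports Defs
begin

text \<open>Write \<open>p, t, q, s\<close> for the doubled areas of \<open>ABC, BCD, CDA, DAB\<close>, so that
  \<open>p + q = s + t = S\<close>. The triangles \<open>ABE, BCF, CDG, DAH\<close> and the inner quadrilateral tile
  \<open>ABCD\<close> like a pinwheel, and \<open>ABE\<close> has doubled area \<open>\<rho>p - \<rho>\<^sup>3pt/d\<close> with
  \<open>d = (1 - \<rho>)p + \<rho>s + \<rho>\<^sup>2t\<close>. Hence the ratio is \<open>1 - 2\<rho> + \<rho>\<^sup>3\<Sigma>/S\<close>, where
  \<open>\<Sigma>\<close> is the cyclic sum of \<open>pt/d\<close>. With \<open>a = p - q\<close> and \<open>b = s - t\<close>, the difference to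
  \<open>M \<rho>\<close> is a positive multiple of \<open>((a + \<rho>b)\<^sup>2 - (b - \<rho>a)\<^sup>2)\<^sup>2\<close>. It vanishes iff
  \<open>a - b = -\<rho>(a + b)\<close> or \<open>a + b = \<rho>(a - b)\<close>. For two values of \<open>\<rho>\<close> this forces
  \<open>a = b = 0\<close>, which characterises parallelograms.\<close>

section \<open>Algebra of signed triangle areas\<close>

lemma orient_rotate: "orient X Y Z = orient Y Z X"
  by (simp add: orient_eq algebra_simps)

lemma orient_swap: "orient Y X Z = - orient X Y Z"
  by (simp add: orient_eq algebra_simps)

lemma orient_degenerate [simp]: "orient X X Y = 0" "orient X Y X = 0" "orient X Y Y = 0"
  by (simp_all add: orient_eq)

lemma orient_rho_point:
  "orient X Y (rho_point \<rho> U V) = (1 - \<rho>) * orient X Y U + \<rho> * orient X Y V"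
  by (simp add: orient_eq rho_point_def algebra_simps)

lemma orient_rho_point_middle:
  "orient X (rho_point \<rho> U V) Y = (1 - \<rho>) * orient X U Y + \<rho> * orient X V Y"
  by (simp add: orient_eq rho_point_def algebra_simps)

lemma orient_rho_points_of_line:
  "orient (rho_point e X Y) (rho_point f X Y) Z = (f - e) * orient X Y Z"
  by (simp add: orient_eq rho_point_def algebra_simps)

lemma orient_sum_diagonals: "orient A B C + orient C D A = orient D A B + orient B C D"
  by (simp add: orient_eq algebra_simps)

text \<open>The affine dependence among four points of the plane, with doubled triangle areas as
  coefficients. In \<open>cevians_meet\<close> a rotated instance makes the two expressions for the
  intersection point agree in each coordinate.\<close>

lemma diagonals_affine_relation:
  "orient B C D * A$i + orient D A B * C$i = orient C D A * B$i + orient A B C * D$i"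
  using exhaust_2[of i] by (auto simp: orient_eq algebra_simps)

text \<open>Each vertex triple occurs twice in the definition of \<open>ccw_convex_quad\<close>, in
  two cyclic orders with the same signed area, so eight inequalities reduce to four.\<close>

lemma ccw_convex_quad_orient:
  "ccw_convex_quad A B C D \<longleftrightarrow>
     orient A B C > 0 \<and> orient B C D > 0 \<and> orient C D A > 0 \<and> orient D A B > 0"
  using orient_rotate[of A B D] orient_rotate[of B D A] orient_rotate[of A B C] 
    orient_rotate[of C D B] orient_rotate[of D B C] orient_rotate[of D A C] orient_rotate[of A C D]
  by (auto simp: ccw_convex_quad_def)

lemma ccw_convex_quad_rotate: "ccw_convex_quad A B C D \<Longrightarrow> ccw_convex_quad B C D A"
  by (auto simp: ccw_convex_quad_orient)

subsection \<open>Areas\<close>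

lemma content_triangle_orient:
  "measure lebesgue (convex hull {A, B, C}) = \<bar>orient A B C\<bar> / 2"
proof -
  have "convex hull {A, B, C} \<in> sets lborel"
    by (simp add: compact_imp_closed compact_convex_hull finite_imp_compact)
  then have "measure lebesgue (convex hull {A, B, C}) = measure lborel (convex hull {A, B, C})"
    by (rule measure_completion)
  also have "\<dots> = \<bar>- orient A B C\<bar> / 2"
  proof -
    have "(C$1 - A$1) * (B$2 - A$2) - (B$1 - A$1) * (C$2 - A$2) = - orient A B C"
      by (simp add: orient_eq algebra_simps)
    then show ?thesis by (simp only: content_triangle)
  qed
  finally show ?thesis by simp
qed

lemma convex_orient_halfplane: "convex {Z. orient X Y Z \<ge> 0}"
proof (rule convexI)
  fix a b :: "real^2" and u v :: real
  assume *: "a \<in> {Z. orient X Y Z \<ge> 0}" "b \<in> {Z. orient X Y Z \<ge> 0}" "0 \<le> u" "0 \<le> v" "u + v = 1"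
  then have v: "v = 1 - u" by simp
  have "orient X Y (u *\<^sub>R a + v *\<^sub>R b) = u * orient X Y a + v * orient X Y b"
    unfolding v by (simp add: orient_eq algebra_simps)
  with * show "u *\<^sub>R a + v *\<^sub>R b \<in> {Z. orient X Y Z \<ge> 0}" by simp
qed

text \<open>The barycentric coordinates of \<open>x\<close> are the signed areas it spans with the
  three sides, divided by \<open>orient A B C\<close>; the hypotheses make them nonnegative.\<close>

lemma convex_hull_triangle_orient:
  assumes "orient A B C > 0" "orient A B x \<ge> 0" "orient B C x \<ge> 0" "orient C A x \<ge> 0"
  shows "x \<in> convex hull {A, B, C}"
proof -
  let ?d = "orient A B C"
  have s: "orient B C x + orient C A x + orient A B x = ?d"
    by (simp add: orient_eq algebra_simps)
  have "?d * x$i = orient B C x * A$i + orient C A x * B$i + orient A B x * C$i" for i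
    using exhaust_2[of i] by (auto simp: orient_eq algebra_simps)
  then have "?d *\<^sub>R x = orient B C x *\<^sub>R A + orient C A x *\<^sub>R B + orient A B x *\<^sub>R C"
    by (simp add: vec_eq_iff)
  then have "(1 / ?d) *\<^sub>R (?d *\<^sub>R x) =
      (1 / ?d) *\<^sub>R (orient B C x *\<^sub>R A + orient C A x *\<^sub>R B + orient A B x *\<^sub>R C)"
    by (rule arg_cong)
  then have "x = (orient B C x / ?d) *\<^sub>R A + (orient C A x / ?d) *\<^sub>R B + (orient A B x / ?d) *\<^sub>R C"
    using assms(1) by (simp add: scaleR_add_right)
  moreover have "orient B C x / ?d + orient C A x / ?d + orient A B x / ?d = 1"
    using s assms(1) by (simp flip: add_divide_distrib)
  ultimately show ?thesis
    using assms unfolding convex_hull_3 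
    by (intro CollectI exI[of _ "orient B C x / ?d"] exI[of _ "orient C A x / ?d"]
        exI[of _ "orient A B x / ?d"]) auto
qed

lemma negligible_line_orient:
  assumes "X \<noteq> Y"
  shows "negligible {Z. orient X Y Z = 0}"
proof -
  let ?a = "vector [- (Y$2 - X$2), Y$1 - X$1] :: real^2"
  have "{Z. orient X Y Z = 0} = {Z. ?a \<bullet> Z = ?a \<bullet> X}"
    by (auto simp: inner_vec_def sum_2 orient_eq algebra_simps)
  moreover have "?a \<noteq> 0"
    using assms by (auto simp: vec_eq_iff forall_2)
  ultimately show ?thesis by (simp add: negligible_hyperplane)
qed

text \<open>The diagonal \<open>A C\<close> splits the hull into two triangles that overlap only in
  a null set.\<close>

lemma quad_area_ccw_convex:
  assumes "ccw_convex_quad A B C D"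
  shows "quad_area A B C D = (orient A B C + orient C D A) / 2"
proof -
  let ?T1 = "convex hull {A, B, C}" and ?T2 = "convex hull {C, D, A}"
  note o = assms[unfolded ccw_convex_quad_def]
  have ne: "A \<noteq> C" using o by auto
  have half: "convex hull {A, B, C, D} \<subseteq> {Z. orient X Y Z \<ge> 0}"
    if "{A, B, C, D} \<subseteq> {Z. orient X Y Z \<ge> 0}" for X Y
    using that by (intro hull_minimal convex_orient_halfplane)
  have "x \<in> ?T1 \<union> ?T2" if x: "x \<in> convex hull {A, B, C, D}" for x
  proof -
    \<comment> \<open>The point is on the inner side of all four sides, so its side of the diagonal
      alone decides which triangle contains it.\<close>
    have "orient A B x \<ge> 0" "orient B C x \<ge> 0" "orient C D x \<ge> 0" "orient D A x \<ge> 0"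
      using half[of A B] half[of B C] half[of C D] half[of D A] x o by auto
    then show ?thesis
      using convex_hull_triangle_orient[of A B C x] convex_hull_triangle_orient[of C D A x]
        o orient_swap[of C A x] by (cases "orient C A x \<ge> 0") auto
  qed
  moreover have "?T1 \<subseteq> convex hull {A, B, C, D}" "?T2 \<subseteq> convex hull {A, B, C, D}"
    by (intro hull_mono; blast)+
  ultimately have un: "convex hull {A, B, C, D} = ?T1 \<union> ?T2" by blast
  have "?T1 \<subseteq> {Z. orient C A Z \<ge> 0}" "?T2 \<subseteq> {Z. orient A C Z \<ge> 0}"
    using o orient_rotate[of A B C] orient_rotate[of B C A] orient_rotate[of C D A]
      orient_rotate[of D A C]
    by (simp_all add: subset_hull convex_orient_halfplane)
  then have "?T1 \<inter> ?T2 \<subseteq> {Z. orient A C Z = 0}"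
    using orient_swap[of C A] by force
  then have "negligible (?T1 \<inter> ?T2)"
    using negligible_line_orient[OF ne] negligible_subset by blast
  moreover have "?T1 \<in> lmeasurable" "?T2 \<in> lmeasurable"
    by (simp_all add: lmeasurable_compact compact_convex_hull finite_imp_compact)
  ultimately have "measure lebesgue (?T1 \<union> ?T2) = measure lebesgue ?T1 + measure lebesgue ?T2"
    using measure_Un3[of ?T1 lebesgue ?T2] negligible_imp_measure0[of "?T1 \<inter> ?T2"] by simp
  then show ?thesis
    using o by (simp add: quad_area_def un content_triangle_orient add_divide_distrib)
qed

subsection \<open>The inner quadrilateral\<close>

lemma rho_point_in_segment: "0 \<le> e \<Longrightarrow> e \<le> 1 \<Longrightarrow> rho_point e X Y \<in> closed_segment X Y"
  unfolding in_segment rho_point_def by (intro exI[of _ e]) (simp add: algebra_simps)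

lemma closed_segment_rho_point:
  assumes "z \<in> closed_segment X Y"
  obtains u where "z = rho_point u X Y"
proof -
  obtain u where "z = (1 - u) *\<^sub>R X + u *\<^sub>R Y"
    using assms unfolding in_segment by blast
  then have "z = rho_point u X Y" by (simp add: rho_point_def algebra_simps)
  then show ?thesis by (rule that)
qed

text \<open>Signed area over \<open>X Y\<close> vanishes on the first segment and is affine and
  nonconstant along the line \<open>X' Y'\<close>, so a common point is unique.\<close>

lemma segment_meet_eqI:
  assumes "P \<in> closed_segment X Y" "P \<in> closed_segment X' Y'"
    and "orient X Y X' \<noteq> orient X Y Y'"
  shows "segment_meet X Y X' Y' = P"
proof -
  have on: "orient X Y z = 0" if "z \<in> closed_segment X Y" for z
    using that by (rule closed_segment_rho_point) (simp add: orient_rho_point)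
  have "z = P" if z: "z \<in> closed_segment X Y" "z \<in> closed_segment X' Y'" for z
  proof -
    obtain a where z': "z = rho_point a X' Y'" using z(2) by (rule closed_segment_rho_point)
    obtain b where P': "P = rho_point b X' Y'" using assms(2) by (rule closed_segment_rho_point)
    have "orient X Y z = orient X Y P" using on z(1) assms(1) by simp
    then have "(a - b) * (orient X Y X' - orient X Y Y') = 0"
      unfolding z' P' orient_rho_point by (simp add: algebra_simps)
    then show ?thesis using assms(3) by (simp add: z' P')
  qed
  then have "closed_segment X Y \<inter> closed_segment X' Y' = {P}" using assms(1,2) by blast
  then show ?thesis by (simp add: segment_meet_def)
qed

text \<open>The Cramer determinant of the lines \<open>A N1\<close> and \<open>B N2\<close>: it
  equals \<open>orient A N1 N2 - orient A N1 B\<close>, the cross product of \<open>N1 - A\<close>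
  and \<open>N2 - B\<close>.\<close>

definition cevian_denom :: "real \<Rightarrow> real^2 \<Rightarrow> real^2 \<Rightarrow> real^2 \<Rightarrow> real^2 \<Rightarrow> real" where
  "cevian_denom \<rho> A B C D =
     (1 - \<rho>) * orient A B C + \<rho> * orient D A B + \<rho>\<^sup>2 * orient B C D"

lemma cevian_denom_pos:
  assumes "ccw_convex_quad A B C D" "0 < \<rho>" "\<rho> < 1"
  shows "cevian_denom \<rho> A B C D > 0"
  using assms by (auto simp: cevian_denom_def ccw_convex_quad_orient intro!: add_pos_pos)

text \<open>Cramer's rule gives the parameter \<open>e\<close> of the intersection on
  \<open>B N2\<close> and \<open>e'\<close> on \<open>A N1\<close>. Both lie strictly between 0 and
  1, so the segments themselves meet.\<close>

lemma cevians_meet: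
  fixes A B C D \<rho>
  assumes "ccw_convex_quad A B C D" "0 < \<rho>" "\<rho> < 1"
  defines "N1 \<equiv> rho_point \<rho> B C" and "N2 \<equiv> rho_point \<rho> C D"
    and "d \<equiv> cevian_denom \<rho> A B C D"
  defines "e \<equiv> \<rho> * orient A B C / d"
    and "e' \<equiv> ((1 - \<rho>) * orient A B C + \<rho> * orient D A B) / d"
  shows "segment_meet A N1 B N2 = rho_point e B N2"
    and "segment_meet A N1 B N2 = rho_point e' A N1"
proof -
  note o = assms(1)[unfolded ccw_convex_quad_orient]
  have d: "d > 0" unfolding d_def using assms(1-3) by (rule cevian_denom_pos)
  \<comment> \<open>Trading \<open>orient B C D\<close> for the other three areas makes every
    coefficient positive; hence \<open>e < 1\<close>.\<close>
  have W: "d - \<rho> * orient A B C =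
      (1 - \<rho>)\<^sup>2 * orient A B C + \<rho> * (1 - \<rho>) * orient D A B + \<rho>\<^sup>2 * orient C D A"
    unfolding d_def cevian_denom_def using orient_sum_diagonals[of A B C D] by algebra
  moreover have Wpos: "\<dots> > 0"
    using o assms(2,3) by (intro add_pos_pos mult_pos_pos) auto
  ultimately have e: "0 < e" "e < 1" using d o assms(2,3) by (auto simp: e_def)
  have e': "0 < e'" "e' < 1" using d o assms(2,3)
    by (auto simp: e'_def intro!: add_pos_pos divide_pos_pos) (auto simp: d_def cevian_denom_def)
  have eq: "rho_point e B N2 = rho_point e' A N1"
  proof -
    \<comment> \<open>Equality of the two points, multiplied by \<open>d\<close> to make it
      polynomial.\<close>
    have "d * B$i + \<rho> * orient A B C * (N2$i - B$i) =
        d * A$i + ((1 - \<rho>) * orient A B C + \<rho> * orient D A B) * (N1$i - A$i)" for i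
      using diagonals_affine_relation[of B C D A i] orient_sum_diagonals[of A B C D]
      unfolding d_def cevian_denom_def N1_def N2_def rho_point_def vector_add_component
        vector_scaleR_component vector_minus_component real_scaleR_def
      by algebra
    moreover have "x + a / d * y = (d * x + a * y) / d" for a x y :: real
      using d by (simp add: field_simps)
    ultimately show ?thesis
      by (simp only: rho_point_def vec_eq_iff e_def e'_def vector_add_component
          vector_scaleR_component vector_minus_component real_scaleR_def simp_thms)
  qed
  \<comment> \<open>The values at \<open>B\<close> and \<open>N2\<close> differ by
    \<open>d > 0\<close>, so the two lines are not parallel.\<close>
  have "orient A N1 B = - \<rho> * orient A B C"
    by (simp add: N1_def orient_rho_point_middle orient_rotate[of A C B] orient_swap[of B C] orient_rotate[of A B C])
  moreover have "orient A N1 N2 = d - \<rho> * orient A B C"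
    using orient_rotate[of D A B] orient_rotate[of C D A] orient_rotate[of D A C]
    unfolding W N1_def N2_def orient_rho_point_middle orient_rho_point orient_degenerate
    by (simp add: power2_eq_square algebra_simps)
  ultimately have "orient A N1 B \<noteq> orient A N1 N2" using d by auto
  then show "segment_meet A N1 B N2 = rho_point e B N2"
    using e e' eq rho_point_in_segment[of e B N2] rho_point_in_segment[of e' A N1]
    by (intro segment_meet_eqI) auto
  with eq show "segment_meet A N1 B N2 = rho_point e' A N1" by simp
qed

text \<open>Both sides are parameters on \<open>B N2\<close>: the left one is that of
  \<open>E\<close>, the right one that of \<open>F\<close>, by \<open>cevians_meet\<close> for the
  rotated quadrilateral. After cross-multiplication the difference is a sum of positive
  terms.\<close>

lemma cevian_params_less:
  assumes "ccw_convex_quad A B C D" "0 < \<rho>" "\<rho> < 1"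
  shows "\<rho> * orient A B C / cevian_denom \<rho> A B C D <
    ((1 - \<rho>) * orient B C D + \<rho> * orient A B C) / cevian_denom \<rho> B C D A" (is "?a / ?d < ?b / ?d'")
proof -
  note o = assms(1)[unfolded ccw_convex_quad_orient]
  have d: "?d > 0" "?d' > 0"
    using assms ccw_convex_quad_rotate[OF assms(1)] by (auto intro: cevian_denom_pos)
  have q: "orient C D A = orient D A B + orient B C D - orient A B C"
    using orient_sum_diagonals[of A B C D] by simp
  have "?b * ?d - ?a * ?d' =
     ((1 - \<rho>)\<^sup>2 * orient A B C + \<rho> * (1 - \<rho>) * orient D A B) * ?b + \<rho>\<^sup>2 * orient C D A * ((1 - \<rho>) * orient B C D)"
    unfolding cevian_denom_def q by algebra
  moreover have "\<dots> > 0"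
    using o assms(2,3) by (intro add_pos_pos mult_pos_pos) auto
  ultimately show ?thesis using d by (simp add: divide_simps mult.commute)
qed

text \<open>\<open>E\<close> precedes \<open>F\<close> on \<open>B N2\<close>, and \<open>F\<close>
  precedes \<open>G\<close> on \<open>C N3\<close>. As \<open>C\<close> is to the right of
  \<open>B N2\<close>, the line \<open>C N3\<close> crosses to the left at \<open>F\<close>, which
  puts \<open>G\<close> on the left.\<close>

lemma orient_inner_pos:
  assumes "ccw_convex_quad A B C D" "0 < \<rho>" "\<rho> < 1"
  defines "N1 \<equiv> rho_point \<rho> B C" and "N2 \<equiv> rho_point \<rho> C D"
    and "N3 \<equiv> rho_point \<rho> D A" and "N4 \<equiv> rho_point \<rho> A B"
  defines "E \<equiv> segment_meet A N1 B N2" and "F \<equiv> segment_meet B N2 C N3"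
    and "G \<equiv> segment_meet C N3 D N4"
  shows "orient E F G > 0"
proof -
  note B = ccw_convex_quad_rotate[OF assms(1)]
  note C = ccw_convex_quad_rotate[OF B]
  note o = assms(1)[unfolded ccw_convex_quad_orient]
  let ?e = "\<rho> * orient A B C / cevian_denom \<rho> A B C D"
  let ?f = "((1 - \<rho>) * orient B C D + \<rho> * orient A B C) / cevian_denom \<rho> B C D A"
  let ?f' = "\<rho> * orient B C D / cevian_denom \<rho> B C D A"
  let ?g = "((1 - \<rho>) * orient C D A + \<rho> * orient B C D) / cevian_denom \<rho> C D A B"
  have E: "E = rho_point ?e B N2" and F: "F = rho_point ?f B N2" "F = rho_point ?f' C N3"
    and G: "G = rho_point ?g C N3"
    unfolding E_def F_def G_def N1_def N2_def N3_def N4_def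
    using cevians_meet[OF assms(1-3)] cevians_meet[OF B assms(2,3)] cevians_meet[OF C assms(2,3)]
    by simp_all
  have lt: "?e < ?f" "?f' < ?g"
    using cevian_params_less[OF assms(1-3)] cevian_params_less[OF B assms(2,3)] by simp_all
  have f': "?f' > 0" using cevian_denom_pos[OF B assms(2,3)] o assms(2) by simp
  have neg: "orient B N2 C = - (\<rho> * orient B C D)"
    by (simp add: N2_def orient_eq rho_point_def algebra_simps)
  have "orient B N2 F = 0" unfolding F(1) orient_rho_point by simp
  then have z: "(1 - ?f') * orient B N2 C + ?f' * orient B N2 N3 = 0"
    unfolding F(2) orient_rho_point .
  \<comment> \<open>An affine function with value \<open>c\<close> at 0 and a zero at
    \<open>f\<close>, evaluated at \<open>g\<close>; the factor \<open>f\<close> avoids a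
    division.\<close>
  have "f * ((1 - g) * c + g * n) = (f - g) * c" if "(1 - f) * c + f * n = 0" for f g c n :: real
    using that by algebra
  from this[OF z] have "?f' * orient B N2 G = (?f' - ?g) * orient B N2 C"
    unfolding G orient_rho_point .
  also have "\<dots> > 0" using lt neg o assms(2) by (intro mult_neg_neg) auto
  finally have "orient B N2 G > 0" using f' zero_less_mult_pos by blast
  then show ?thesis
    unfolding E F(1) orient_rho_points_of_line using lt by simp
qed

section \<open>The area ratio from the pinwheel tiling\<close>

text \<open>A polynomial identity for eight arbitrary points, replacing a geometric tiling argument.
  The last four terms vanish once the inner vertices lie on the cevians.\<close>

lemma pinwheel_decomposition:
  "orient E F G + orient G H E + (orient A B E + orient B C F + orient C D G + orient D A H) =
     orient A B C + orient C D A + (orient B E F + orient C F G + orient D G H + orient A H E)"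
  by (simp add: orient_eq algebra_simps)

text \<open>Since \<open>E\<close> lies on \<open>B N2\<close> with known parameter, its signed area
  over \<open>A B\<close> is that parameter times the one of \<open>N2\<close>, which is
  \<open>d - \<rho>\<^sup>2 t\<close>.\<close>

lemma outer_triangle:
  assumes "ccw_convex_quad A B C D" "0 < \<rho>" "\<rho> < 1"
  shows "orient A B (segment_meet A (rho_point \<rho> B C) B (rho_point \<rho> C D)) =
    \<rho> * orient A B C - \<rho>^3 * (orient A B C * orient B C D / cevian_denom \<rho> A B C D)"
    (is "orient A B ?E = \<rho> * ?p - \<rho>^3 * (?p * ?t / ?d)")
proof -
  have d: "?d > 0" using assms by (rule cevian_denom_pos)
  have "orient A B ?E = \<rho> * ?p / ?d * ((1 - \<rho>) * ?p + \<rho> * orient A B D)"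
    unfolding cevians_meet(1)[OF assms] by (simp add: orient_rho_point)
  also have "(1 - \<rho>) * ?p + \<rho> * orient A B D = ?d - \<rho>\<^sup>2 * ?t"
    by (simp add: cevian_denom_def orient_rotate[of D A B])
  also have "\<rho> * ?p / ?d * (?d - \<rho>\<^sup>2 * ?t) = \<rho> * ?p - \<rho>^3 * (?p * ?t / ?d)"
    using d by (simp add: field_simps power2_eq_square power3_eq_cube)
  finally show ?thesis .
qed

lemma orient_along_cevian:
  assumes "ccw_convex_quad A B C D" "0 < \<rho>" "\<rho> < 1"
  defines "N1 \<equiv> rho_point \<rho> B C" and "N2 \<equiv> rho_point \<rho> C D" and "N3 \<equiv> rho_point \<rho> D A"
  shows "orient B (segment_meet A N1 B N2) (segment_meet B N2 C N3) = 0"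
proof -
  have "orient B (rho_point e B N2) (rho_point f B N2) = 0" for e f
    by (simp add: orient_eq rho_point_def)
  then show ?thesis
    unfolding N1_def N2_def N3_def cevians_meet(1)[OF assms(1-3)]
      cevians_meet(2)[OF ccw_convex_quad_rotate[OF assms(1)] assms(2,3)] by simp
qed

text \<open>The outer triangles are subtracted from the whole. Their linear terms add up to
  \<open>2 * \<rho> * (p + q)\<close> because \<open>p + q = s + t\<close>.\<close>

lemma area_ratio_eq:
  assumes "ccw_convex_quad A B C D" "0 < \<rho>" "\<rho> < 1"
  defines "p \<equiv> orient A B C" and "t \<equiv> orient B C D" and "q \<equiv> orient C D A" and "s \<equiv> orient D A B"
  shows "area_ratio \<rho> A B C D = 1 - 2 * \<rho> + \<rho>^3 *
     ((p * t / cevian_denom \<rho> A B C D + t * q / cevian_denom \<rho> B C D A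
       + q * s / cevian_denom \<rho> C D A B + s * p / cevian_denom \<rho> D A B C) / (p + q))"
proof -
  note 1 = assms(1)
  note 2 = ccw_convex_quad_rotate[OF 1]
  note 3 = ccw_convex_quad_rotate[OF 2]
  note 4 = ccw_convex_quad_rotate[OF 3]
  define N1 where "N1 = rho_point \<rho> B C"
  define N2 where "N2 = rho_point \<rho> C D"
  define N3 where "N3 = rho_point \<rho> D A"
  define N4 where "N4 = rho_point \<rho> A B"
  define E where "E = segment_meet A N1 B N2"
  define F where "F = segment_meet B N2 C N3"
  define G where "G = segment_meet C N3 D N4"
  define H where "H = segment_meet D N4 A N1"
  note N = N1_def N2_def N3_def N4_def
  note EFGH = E_def F_def G_def H_def
  have "ccw_convex_quad E F G H"
    \<comment> \<open>The four rotations of the outer quadrilateral supply the four corners of the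
      inner one.\<close>
    using orient_inner_pos[OF 1 assms(2,3)] orient_inner_pos[OF 2 assms(2,3)]
      orient_inner_pos[OF 3 assms(2,3)] orient_inner_pos[OF 4 assms(2,3)]
    by (simp add: ccw_convex_quad_orient EFGH N)
  then have inner: "inner_area \<rho> A B C D = (orient E F G + orient G H E) / 2"
    unfolding inner_area_def Let_def EFGH N by (rule quad_area_ccw_convex)
  have outer: "quad_area A B C D = (p + q) / 2"
    using quad_area_ccw_convex[OF 1] by (simp add: p_def q_def)
  have pos: "p + q > 0" and eq: "p + q = s + t"
    using 1 orient_sum_diagonals[of A B C D]
    by (simp_all add: ccw_convex_quad_orient p_def q_def s_def t_def)
  have "orient B E F = 0" "orient C F G = 0" "orient D G H = 0" "orient A H E = 0"
    using orient_along_cevian[OF 1 assms(2,3)] orient_along_cevian[OF 2 assms(2,3)]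
      orient_along_cevian[OF 3 assms(2,3)] orient_along_cevian[OF 4 assms(2,3)]
    by (simp_all add: EFGH N)
  then have "orient E F G + orient G H E =
      (p + q) - (orient A B E + orient B C F + orient C D G + orient D A H)"
    using pinwheel_decomposition[of E F G H A B C D] by (simp add: p_def q_def)
  also have "orient A B E + orient B C F + orient C D G + orient D A H = 2 * \<rho> * (p + q) - \<rho>^3 *
     (p * t / cevian_denom \<rho> A B C D + t * q / cevian_denom \<rho> B C D A
       + q * s / cevian_denom \<rho> C D A B + s * p / cevian_denom \<rho> D A B C)"
    (is "_ = 2 * \<rho> * (p + q) - \<rho>^3 * ?X")
  proof -
    have "\<rho> * p + \<rho> * t + \<rho> * q + \<rho> * s = 2 * \<rho> * (p + q)"
      using eq by algebra
    then show ?thesis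
      using outer_triangle[OF 1 assms(2,3)] outer_triangle[OF 2 assms(2,3)]
        outer_triangle[OF 3 assms(2,3)] outer_triangle[OF 4 assms(2,3)]
      by (simp add: EFGH N p_def q_def s_def t_def distrib_left)
  qed
  finally have T: "orient E F G + orient G H E = (p + q) - (2 * \<rho> * (p + q) - \<rho>^3 * ?X)" .
  have "T / 2 / (S / 2) = 1 - 2 * \<rho> + \<rho>^3 * (X / S)"
    if "T = S - (2 * \<rho> * S - \<rho>^3 * X)" "S > 0" for T S X
    using that by (simp add: field_simps)
  from this[OF T pos] show ?thesis
    unfolding area_ratio_def inner outer .
qed

section \<open>Comparison with the maximal value\<close>

text \<open>The comparison with denominators cleared. The factor 16 matches
  \<open>(u\<^sup>2 - v\<^sup>2)\<^sup>2\<close>: under \<open>p + q = s + t\<close>,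
  \<open>u - v\<close> is \<open>2 * ((p - s) + r * (p - t))\<close> and \<open>u + v\<close> is
  \<open>2 * ((p - t) - r * (p - s))\<close>.\<close>

lemma deficit_identity:
  fixes r p q s t :: real
  assumes "p + q = s + t"
  defines "DB \<equiv> (1 - r) * p + r * s + r\<^sup>2 * t" and "DC \<equiv> (1 - r) * t + r * p + r\<^sup>2 * q"
    and "DD \<equiv> (1 - r) * q + r * t + r\<^sup>2 * s" and "DA \<equiv> (1 - r) * s + r * q + r\<^sup>2 * p"
    and "u \<equiv> (p - q) + r * (s - t)" and "v \<equiv> (s - t) - r * (p - q)"
  shows "16 * ((r\<^sup>2 + 1) * (p * t * DC * DD * DA + t * q * DB * DD * DA + q * s * DB * DC * DA + s * p * DB * DC * DD))
     = 16 * (2 * (p + q) * (DA * DB * DC * DD)) - (p + q) * (1 - r)\<^sup>2 * r * (u\<^sup>2 - v\<^sup>2)\<^sup>2"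
proof -
  have q: "q = s + t - p" using assms(1) by simp
  show ?thesis unfolding DB_def DC_def DD_def DA_def u_def v_def q by algebra
qed

lemma M_minus_area_ratio:
  assumes "ccw_convex_quad A B C D" "0 < \<rho>" "\<rho> < 1"
  defines "a \<equiv> orient A B C - orient C D A" and "b \<equiv> orient D A B - orient B C D"
  obtains c where "c > 0" "M \<rho> - area_ratio \<rho> A B C D = c * ((a + \<rho> * b)\<^sup>2 - (b - \<rho> * a)\<^sup>2)\<^sup>2"
proof -
  note 1 = assms(1)
  note 2 = ccw_convex_quad_rotate[OF 1]
  note 3 = ccw_convex_quad_rotate[OF 2]
  note 4 = ccw_convex_quad_rotate[OF 3]
  define p where "p = orient A B C"
  define t where "t = orient B C D"
  define q where "q = orient C D A"
  define s where "s = orient D A B"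
  define DB where "DB = cevian_denom \<rho> A B C D"
  define DC where "DC = cevian_denom \<rho> B C D A"
  define DD where "DD = cevian_denom \<rho> C D A B"
  define DA where "DA = cevian_denom \<rho> D A B C"
  define w where "w = ((a + \<rho> * b)\<^sup>2 - (b - \<rho> * a)\<^sup>2)\<^sup>2"
  define X where "X = p * t * DC * DD * DA + t * q * DB * DD * DA + q * s * DB * DC * DA + s * p * DB * DC * DD"
  define P where "P = DA * DB * DC * DD"
  have D: "DB > 0" "DC > 0" "DD > 0" "DA > 0"
    using 1 2 3 4 assms(2,3) by (simp_all add: DB_def DC_def DD_def DA_def cevian_denom_pos)
  then have P: "P > 0" by (simp add: P_def)
  have pos: "p + q > 0" and eq: "p + q = s + t"
    using 1 orient_sum_diagonals[of A B C D]
    by (simp_all add: ccw_convex_quad_orient p_def q_def s_def t_def)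
  have n: "\<rho>\<^sup>2 + 1 > 0" by (simp add: add_nonneg_pos)
  have I: "16 * ((\<rho>\<^sup>2 + 1) * X) = 16 * (2 * (p + q) * P) - (p + q) * (1 - \<rho>)\<^sup>2 * \<rho> * w"
    using deficit_identity[OF eq, of \<rho>]
    by (simp only: X_def P_def w_def a_def b_def DB_def DC_def DD_def DA_def
        cevian_denom_def p_def[symmetric] q_def[symmetric] s_def[symmetric] t_def[symmetric])
  have "area_ratio \<rho> A B C D = 1 - 2 * \<rho> + \<rho>^3 * ((p * t / DB + t * q / DC + q * s / DD + s * p / DA) / (p + q))"
    using area_ratio_eq[OF assms(1-3)]
    by (simp only: p_def q_def s_def t_def DB_def DC_def DD_def DA_def)
  also have "p * t / DB + t * q / DC + q * s / DD + s * p / DA = X / P"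
    using D by (simp add: X_def P_def field_simps)
  finally have r: "area_ratio \<rho> A B C D = 1 - 2 * \<rho> + \<rho>^3 * (X / P / (p + q))" .
  \<comment> \<open>In this shape \<open>M \<rho>\<close> and the ratio differ only in the factor of
    \<open>\<rho>^3\<close>.\<close>
  have M: "M \<rho> = 1 - 2 * \<rho> + \<rho>^3 * (2 / (\<rho>\<^sup>2 + 1))"
    using n by (simp add: M_def field_simps power2_eq_square power3_eq_cube)
  have "2 / (\<rho>\<^sup>2 + 1) - X / P / (p + q) = (2 * (p + q) * P - (\<rho>\<^sup>2 + 1) * X) / ((\<rho>\<^sup>2 + 1) * P * (p + q))"
    using n P pos by (simp add: divide_simps)
  also have "2 * (p + q) * P - (\<rho>\<^sup>2 + 1) * X = (p + q) * ((1 - \<rho>)\<^sup>2 * \<rho> * w / 16)"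
    using I by (simp add: algebra_simps)
  also have "\<dots> / ((\<rho>\<^sup>2 + 1) * P * (p + q)) = (1 - \<rho>)\<^sup>2 * \<rho> / (16 * ((\<rho>\<^sup>2 + 1) * P)) * w"
    using pos by simp
  finally have "\<rho>^3 * (2 / (\<rho>\<^sup>2 + 1) - X / P / (p + q)) =
      \<rho>^3 * ((1 - \<rho>)\<^sup>2 * \<rho> / (16 * ((\<rho>\<^sup>2 + 1) * P))) * w" by simp
  moreover have "M \<rho> - area_ratio \<rho> A B C D = \<rho>^3 * (2 / (\<rho>\<^sup>2 + 1) - X / P / (p + q))"
    unfolding M r by (simp add: right_diff_distrib)
  moreover have "\<rho>^3 * ((1 - \<rho>)\<^sup>2 * \<rho> / (16 * ((\<rho>\<^sup>2 + 1) * P))) > 0"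
    using assms(2,3) n P by (intro mult_pos_pos divide_pos_pos) auto
  ultimately show ?thesis using that unfolding w_def by metis
qed

lemma area_ratio_le:
  assumes "ccw_convex_quad A B C D" "0 < \<rho>" "\<rho> < 1"
  shows "area_ratio \<rho> A B C D \<le> M \<rho>"
proof -
  obtain c where "c > 0" "M \<rho> - area_ratio \<rho> A B C D =
    c * (((orient A B C - orient C D A) + \<rho> * (orient D A B - orient B C D))\<^sup>2
      - ((orient D A B - orient B C D) - \<rho> * (orient A B C - orient C D A))\<^sup>2)\<^sup>2"
    using M_minus_area_ratio[OF assms] .
  then have "M \<rho> - area_ratio \<rho> A B C D \<ge> 0" by simp
  then show ?thesis by simp
qed

section \<open>The equality case and parallelograms\<close>

text \<open>The difference of squares in the deficit factors into two forms linear in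
  \<open>a\<close> and \<open>b\<close>, one for each alternative.\<close>

lemma area_ratio_eq_M_iff:
  assumes "ccw_convex_quad A B C D" "0 < \<rho>" "\<rho> < 1"
  defines "a \<equiv> orient A B C - orient C D A" and "b \<equiv> orient D A B - orient B C D"
  shows "area_ratio \<rho> A B C D = M \<rho> \<longleftrightarrow> a - b = - \<rho> * (a + b) \<or> a + b = \<rho> * (a - b)"
proof -
  obtain c where c: "c > 0"
    "M \<rho> - area_ratio \<rho> A B C D = c * ((a + \<rho> * b)\<^sup>2 - (b - \<rho> * a)\<^sup>2)\<^sup>2"
    using M_minus_area_ratio[OF assms(1-3)] unfolding a_def b_def .
  have "area_ratio \<rho> A B C D = M \<rho> \<longleftrightarrow> c * ((a + \<rho> * b)\<^sup>2 - (b - \<rho> * a)\<^sup>2)\<^sup>2 = 0"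
    unfolding c(2)[symmetric] by auto
  also have "\<dots> \<longleftrightarrow> (a + \<rho> * b)\<^sup>2 - (b - \<rho> * a)\<^sup>2 = 0"
    using c(1) by simp
  also have "(a + \<rho> * b)\<^sup>2 - (b - \<rho> * a)\<^sup>2 = (a - b + \<rho> * (a + b)) * (a + b - \<rho> * (a - b))"
    by algebra
  finally show ?thesis by (simp add: eq_neg_iff_add_eq_0)
qed

text \<open>The cross products of opposite sides are differences of adjacent triangle areas. With
  the diagonal sum relation, either condition amounts to equality of all four areas.\<close>

lemma parallelogram_iff_orient:
  "parallelogram A B C D \<longleftrightarrow> orient A B C = orient C D A \<and> orient D A B = orient B C D"
proof -
  have "orient 0 (B - A) (D - C) = orient D A B - orient A B C"
    "orient 0 (C - B) (A - D) = orient A B C - orient B C D"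
    by (simp_all add: orient_eq algebra_simps)
  then show ?thesis
    using orient_sum_diagonals[of A B C D]
    by (auto simp: parallelogram_def collinear_iff_orient)
qed

theorem mainTheorem4:
  shows "(\<forall>\<rho>\<in>{0<..<1}.
            (\<exists>A B C D. ccw_convex_quad A B C D \<and> area_ratio \<rho> A B C D = M \<rho>) \<and>
            (\<forall>A B C D. ccw_convex_quad A B C D \<longrightarrow> area_ratio \<rho> A B C D \<le> M \<rho>))
       \<and> (\<forall>A B C D. ccw_convex_quad A B C D \<and> parallelogram A B C D \<longrightarrow>
            (\<forall>\<rho>\<in>{0<..<1}. area_ratio \<rho> A B C D = M \<rho>))
       \<and> (\<forall>A B C D. ccw_convex_quad A B C D \<and>
            (\<exists>\<rho>\<^sub>1\<in>{0<..<1}. \<exists>\<rho>\<^sub>2\<in>{0<..<1}. \<rho>\<^sub>1 \<noteq> \<rho>\<^sub>2 \<and>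
               area_ratio \<rho>\<^sub>1 A B C D = M \<rho>\<^sub>1 \<and> area_ratio \<rho>\<^sub>2 A B C D = M \<rho>\<^sub>2) \<longrightarrow>
            parallelogram A B C D)"
proof (intro conjI ballI allI impI)
  have par: "area_ratio \<rho> A B C D = M \<rho>"
    if "ccw_convex_quad A B C D" "parallelogram A B C D" "\<rho> \<in> {0<..<1}" for A B C D \<rho>
    using that by (subst area_ratio_eq_M_iff) (auto simp: parallelogram_iff_orient)
  then show "area_ratio \<rho> A B C D = M \<rho>"
    if "ccw_convex_quad A B C D \<and> parallelogram A B C D" "\<rho> \<in> {0<..<1}" for A B C D \<rho>
    using that by blast
  show "area_ratio \<rho> A B C D \<le> M \<rho>"
    if "\<rho> \<in> {0<..<1}" "ccw_convex_quad A B C D" for \<rho> A B C D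
    using that area_ratio_le by simp
  show "\<exists>A B C D. ccw_convex_quad A B C D \<and> area_ratio \<rho> A B C D = M \<rho>"
    if "\<rho> \<in> {0<..<1}" for \<rho>
  proof -
    \<comment> \<open>The unit square attains the maximum, being a parallelogram.\<close>
    let ?A = "vector [0, 0] :: real^2" and ?B = "vector [1, 0] :: real^2"
    let ?C = "vector [1, 1] :: real^2" and ?D = "vector [0, 1] :: real^2"
    have "ccw_convex_quad ?A ?B ?C ?D"
      by (simp add: ccw_convex_quad_orient orient_eq)
    moreover have "parallelogram ?A ?B ?C ?D"
      by (simp add: parallelogram_iff_orient orient_eq)
    ultimately show ?thesis using par that by blast
  qed
  show "parallelogram A B C D"
    if H: "ccw_convex_quad A B C D \<and> (\<exists>\<rho>\<^sub>1\<in>{0<..<1}. \<exists>\<rho>\<^sub>2\<in>{0<..<1}. \<rho>\<^sub>1 \<noteq> \<rho>\<^sub>2 \<and>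
               area_ratio \<rho>\<^sub>1 A B C D = M \<rho>\<^sub>1 \<and> area_ratio \<rho>\<^sub>2 A B C D = M \<rho>\<^sub>2)" for A B C D
  proof -
    define x where "x = (orient A B C - orient C D A) - (orient D A B - orient B C D)"
    define y where "y = (orient A B C - orient C D A) + (orient D A B - orient B C D)"
    from H obtain \<rho> \<sigma> where \<rho>\<sigma>: "0 < \<rho>" "\<rho> < 1" "0 < \<sigma>" "\<sigma> < 1" "\<rho> \<noteq> \<sigma>"
      and "area_ratio \<rho> A B C D = M \<rho>" "area_ratio \<sigma> A B C D = M \<sigma>" by auto
    then have xy: "x = - \<rho> * y \<or> y = \<rho> * x" "x = - \<sigma> * y \<or> y = \<sigma> * x"
      using H area_ratio_eq_M_iff unfolding x_def y_def by blast+
    have prod: "\<rho> * \<sigma> > 0" using \<rho>\<sigma> by simp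
    have "x = 0 \<and> y = 0"
    proof -
      \<comment> \<open>Settles the mixed cases, such as \<open>x = - \<rho> * y\<close> with
        \<open>y = \<sigma> * x\<close>. If both parameters satisfy the same alternative,
        \<open>\<rho> \<noteq> \<sigma>\<close> suffices.\<close>
      have "z = 0" if "\<rho> * \<sigma> * z = - z" for z
      proof -
        have "(\<rho> * \<sigma> + 1) * z = 0" using that by (simp add: distrib_right)
        then show ?thesis using prod by simp
      qed
      then show ?thesis using xy \<rho>\<sigma> by (auto simp: mult.assoc mult.left_commute)
    qed
    then show ?thesis by (simp add: parallelogram_iff_orient x_def y_def)
  qed
qed

end
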